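(* Let $(M,g)$ be a (pseudo-)Riemannian manifold whose metric is factorized as $g_{ab}=A_a\odot A_b=\sum_{I=1}^{n}A_{Ia}A_{Ib}$ by a set of pointwise linearly independent complex-valued $1$-forms $\mathbf{A}_1,\dots,\mathbf{A}_n$ on $M$. Let $F_{Iab}=\nabla_aA_{Ib}-\nabla_bA_{Ia}$, $S_{Iab}=\tfrac12(\nabla_aA_{Ib}+\nabla_bA_{Ia})$ and $J_{Iabc}=\nabla_aF_{Ibc}$. Then the Riemann curvature tensor decomposes as $$R_{abcd}=R^{(c)}_{abcd}+R^{(f)}_{abcd}+R^{(s)}_{abcd},$$ where $$R^{(c)}_{abcd}=\tfrac12\left(A_a\odot J_{bcd}-A_b\odot J_{acd}+A_c\odot J_{dab}-A_d\odot J_{cab}\right),$$ $$R^{(f)}_{abcd}=\tfrac14\left(F_{ad}\odot F_{bc}-F_{ac}\odot F_{bd}-2F_{ab}\odot F_{cd}\right),$$ $$R^{(s)}_{abcd}=S_{ac}\odot S_{bd}-S_{ad}\odot S_{bc}.$$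
   Context: $M$ is an $n$-dimensional compact, differentiable, oriented and connected manifold with a metric $g$ locally reducible at each point to $\mathrm{diag}(1,\dots,1,-1,\dots,-1)$ ($r$ plus signs and $s=n-r$ minus signs; $s=0$ is the positive definite case). The metric is written, by a Takagi factorization, as $g_{ab}=\sum_{I=1}^n A_{Ia}A_{Ib}$, where $\mathbf{A}_I=A_{Ia}\,\mathbf{w}^a$ ($I=1,\dots,n$) are smooth $1$-forms on $M$, possibly complex-valued, linearly independent at each point; $\mathbf{w}^a$ is the dual of the basis of the tangent space. The index $I$ enumerates the forms and is not a tensor index; lower-case indices are tensor component indices. The set product $\odot$ sums over the enumeration index: $T_{a\dots}\odot U_{b\dots}=\sum_{I=1}^n T_{Ia\dots}U_{Ib\dots}$. $\nabla$ is the Levi-Civita covariant derivative of $g$, with $\nabla_aA_{Ib}=\partial_aA_{Ib}-\Gamma^c{}_{ab}A_{Ic}$. Curvature convention (coordinate basis): $R^a{}_{bcd}=\partial_c\Gamma^a{}_{bd}-\partial_d\Gamma^a{}_{bc}+\Gamma^a{}_{ec}\Gamma^e{}_{bd}-\Gamma^a{}_{ed}\Gamma^e{}_{bc}$ and $R_{abcd}=g_{ae}R^e{}_{bcd}$. *)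

theory Defs
  imports "HOL-Analysis.Analysis"
begin

section \<open>Smooth functions on open subsets of Euclidean space\<close>

definition partial_deriv ::
    "'n::finite \<Rightarrow> (real^'n \<Rightarrow> 'b::real_normed_vector) \<Rightarrow> real^'n \<Rightarrow> 'b"
  where "partial_deriv a f x = frechet_derivative f (at x) (axis a 1)"

text \<open>The following two notions are meant for open sets only.\<close>

primrec Ck_on :: "nat \<Rightarrow> (real^'n::finite \<Rightarrow> 'b::real_normed_vector) \<Rightarrow> (real^'n) set \<Rightarrow> bool"
  where
    "Ck_on 0 f S \<longleftrightarrow> continuous_on S f"
  | "Ck_on (Suc k) f S \<longleftrightarrow> f differentiable_on S \<and> (\<forall>a. Ck_on k (partial_deriv a f) S)"

definition smooth_on :: "(real^'n::finite \<Rightarrow> 'b::real_normed_vector) \<Rightarrow> (real^'n) set \<Rightarrow> bool"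
  where "smooth_on f S \<longleftrightarrow> (\<forall>k. Ck_on k f S)"


section \<open>Differentiable manifolds\<close>

text \<open>A chart is a domain together with a coordinate map; only the values of the map
  on the domain matter. The dimension of the manifold is \<open>CARD('n)\<close>.\<close>

type_synonym ('m, 'n) chart = "'m set \<times> ('m \<Rightarrow> real^'n)"

definition is_chart :: "'m topology \<Rightarrow> ('m, 'n::finite) chart \<Rightarrow> bool"
  where "is_chart X \<kappa> \<longleftrightarrow> openin X (fst \<kappa>) \<and> open (snd \<kappa> ` fst \<kappa>) \<and>
    homeomorphic_map (subtopology X (fst \<kappa>)) (top_of_set (snd \<kappa> ` fst \<kappa>)) (snd \<kappa>)"

definition coord_range :: "('m, 'n::finite) chart \<Rightarrow> (real^'n) set"
  where "coord_range \<kappa> = snd \<kappa> ` fst \<kappa>"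

definition overlap :: "('m, 'n::finite) chart \<Rightarrow> ('m, 'n) chart \<Rightarrow> (real^'n) set"
  where "overlap \<kappa> \<mu> = snd \<kappa> ` (fst \<kappa> \<inter> fst \<mu>)"

definition transition :: "('m, 'n::finite) chart \<Rightarrow> ('m, 'n) chart \<Rightarrow> real^'n \<Rightarrow> real^'n"
  where "transition \<kappa> \<mu> x = snd \<mu> (inv_into (fst \<kappa>) (snd \<kappa>) x)"

text \<open>The entry in row \<open>e\<close> and column \<open>a\<close> is the derivative of the new coordinate \<open>e\<close>
  with respect to the old coordinate \<open>a\<close>.\<close>

definition jacobian :: "('m, 'n::finite) chart \<Rightarrow> ('m, 'n) chart \<Rightarrow> real^'n \<Rightarrow> real^'n^'n"
  where "jacobian \<kappa> \<mu> x = matrix (frechet_derivative (transition \<kappa> \<mu>) (at x))"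

definition compatible_charts :: "('m, 'n::finite) chart \<Rightarrow> ('m, 'n) chart \<Rightarrow> bool"
  where "compatible_charts \<kappa> \<mu> \<longleftrightarrow>
    smooth_on (transition \<kappa> \<mu>) (overlap \<kappa> \<mu>) \<and> smooth_on (transition \<mu> \<kappa>) (overlap \<mu> \<kappa>)"

definition smooth_atlas :: "'m topology \<Rightarrow> ('m, 'n::finite) chart set \<Rightarrow> bool"
  where "smooth_atlas X \<A> \<longleftrightarrow>
    (\<forall>\<kappa>\<in>\<A>. is_chart X \<kappa>) \<and> (\<Union>\<kappa>\<in>\<A>. fst \<kappa>) = topspace X \<and>
    (\<forall>\<kappa>\<in>\<A>. \<forall>\<mu>\<in>\<A>. compatible_charts \<kappa> \<mu>)"

definition smooth_manifold :: "'m topology \<Rightarrow> ('m, 'n::finite) chart set \<Rightarrow> bool"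
  where "smooth_manifold X \<A> \<longleftrightarrow>
    Hausdorff_space X \<and> second_countable X \<and> smooth_atlas X \<A> \<and>
    (\<forall>\<kappa>. is_chart X \<kappa> \<and> (\<forall>\<mu>\<in>\<A>. compatible_charts \<kappa> \<mu>) \<longrightarrow> \<kappa> \<in> \<A>)"

text \<open>An orientation is given by a subatlas whose transition maps have positive Jacobian
  determinant.\<close>

definition oriented_by ::
    "'m topology \<Rightarrow> ('m, 'n::finite) chart set \<Rightarrow> ('m, 'n) chart set \<Rightarrow> bool"
  where "oriented_by X \<A> \<O> \<longleftrightarrow> \<O> \<subseteq> \<A> \<and> smooth_atlas X \<O> \<and>
    (\<forall>\<kappa>\<in>\<O>. \<forall>\<mu>\<in>\<O>. \<forall>x\<in>overlap \<kappa> \<mu>. det (jacobian \<kappa> \<mu> x) > 0)"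


section \<open>One-forms and metrics\<close>

text \<open>Tensor fields are given by their components in the coordinate bases: for every chart
  there is a component function of the coordinates, and the component functions of any two
  charts are related by the tensor transformation law.\<close>

definition one_form ::
    "('m, 'n::finite) chart set \<Rightarrow> (('m, 'n) chart \<Rightarrow> real^'n \<Rightarrow> complex^'n) \<Rightarrow> bool"
  where "one_form \<A> \<omega> \<longleftrightarrow>
    (\<forall>\<kappa>\<in>\<A>. smooth_on (\<omega> \<kappa>) (coord_range \<kappa>)) \<and>
    (\<forall>\<kappa>\<in>\<A>. \<forall>\<mu>\<in>\<A>. \<forall>x\<in>overlap \<kappa> \<mu>. \<forall>a.
      \<omega> \<kappa> x $ a =
        (\<Sum>e\<in>UNIV. complex_of_real (jacobian \<kappa> \<mu> x $ e $ a) * \<omega> \<mu> (transition \<kappa> \<mu> x) $ e))"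

text \<open>Since the index type is unordered, the positions of the plus signs in the normal form
  of the metric are given by a set \<open>P\<close> of cardinality \<open>r\<close>.\<close>

definition has_signature :: "real^'n^'n::finite \<Rightarrow> nat \<Rightarrow> bool"
  where "has_signature G r \<longleftrightarrow>
    (\<exists>(B::real^'n^'n) P. invertible B \<and> card P = r \<and>
      transpose B ** G ** B = (\<chi> a b. if a = b then (if a \<in> P then 1 else - 1) else 0))"

definition pseudo_riemannian_metric ::
    "('m, 'n::finite) chart set \<Rightarrow> nat \<Rightarrow> (('m, 'n) chart \<Rightarrow> real^'n \<Rightarrow> real^'n^'n) \<Rightarrow> bool"
  where "pseudo_riemannian_metric \<A> r g \<longleftrightarrow>
    (\<forall>\<kappa>\<in>\<A>. smooth_on (g \<kappa>) (coord_range \<kappa>)) \<and>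
    (\<forall>\<kappa>\<in>\<A>. \<forall>\<mu>\<in>\<A>. \<forall>x\<in>overlap \<kappa> \<mu>.
      g \<kappa> x = transpose (jacobian \<kappa> \<mu> x) ** g \<mu> (transition \<kappa> \<mu> x) ** jacobian \<kappa> \<mu> x) \<and>
    (\<forall>\<kappa>\<in>\<A>. \<forall>x\<in>coord_range \<kappa>. transpose (g \<kappa> x) = g \<kappa> x \<and> has_signature (g \<kappa> x) r)"

definition pointwise_independent ::
    "('m, 'n::finite) chart set \<Rightarrow> ('i \<Rightarrow> ('m, 'n) chart \<Rightarrow> real^'n \<Rightarrow> complex^'n) \<Rightarrow> bool"
  where "pointwise_independent \<A> A \<longleftrightarrow>
    (\<forall>\<kappa>\<in>\<A>. \<forall>x\<in>coord_range \<kappa>.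
      inj (\<lambda>I. A I \<kappa> x) \<and> vec.independent (range (\<lambda>I. A I \<kappa> x)))"

definition set_product :: "('i::finite \<Rightarrow> complex) \<Rightarrow> ('i \<Rightarrow> complex) \<Rightarrow> complex" (infixl "\<odot>" 70)
  where "T \<odot> U = (\<Sum>I\<in>UNIV. T I * U I)"

definition factorizes_metric ::
    "('m, 'n::finite) chart set \<Rightarrow> ('i::finite \<Rightarrow> ('m, 'n) chart \<Rightarrow> real^'n \<Rightarrow> complex^'n)
      \<Rightarrow> (('m, 'n) chart \<Rightarrow> real^'n \<Rightarrow> real^'n^'n) \<Rightarrow> bool"
  where "factorizes_metric \<A> A g \<longleftrightarrow>
    (\<forall>\<kappa>\<in>\<A>. \<forall>x\<in>coord_range \<kappa>. \<forall>a b.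
      complex_of_real (g \<kappa> x $ a $ b) = (\<lambda>I. A I \<kappa> x $ a) \<odot> (\<lambda>I. A I \<kappa> x $ b))"


section \<open>Levi-Civita derivative and curvature in a chart\<close>

text \<open>Here \<open>G\<close> is the component function of the metric in one fixed chart, and similarly for the
  other tensor fields.\<close>

definition christoffel ::
    "(real^'n::finite \<Rightarrow> real^'n^'n) \<Rightarrow> real^'n \<Rightarrow> 'n \<Rightarrow> 'n \<Rightarrow> 'n \<Rightarrow> real"
  where "christoffel G x c a b =
    1/2 * (\<Sum>d\<in>UNIV. matrix_inv (G x) $ c $ d *
      (partial_deriv a (\<lambda>y. G y $ d $ b) x + partial_deriv b (\<lambda>y. G y $ d $ a) x
        - partial_deriv d (\<lambda>y. G y $ a $ b) x))"

definition cov_deriv_1 ::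
    "(real^'n::finite \<Rightarrow> real^'n^'n) \<Rightarrow> (real^'n \<Rightarrow> complex^'n) \<Rightarrow> real^'n \<Rightarrow> 'n \<Rightarrow> 'n \<Rightarrow> complex"
  where "cov_deriv_1 G \<omega> x a b =
    partial_deriv a (\<lambda>y. \<omega> y $ b) x
      - (\<Sum>c\<in>UNIV. complex_of_real (christoffel G x c a b) * \<omega> x $ c)"

definition cov_deriv_2 ::
    "(real^'n::finite \<Rightarrow> real^'n^'n) \<Rightarrow> (real^'n \<Rightarrow> 'n \<Rightarrow> 'n \<Rightarrow> complex)
      \<Rightarrow> real^'n \<Rightarrow> 'n \<Rightarrow> 'n \<Rightarrow> 'n \<Rightarrow> complex"
  where "cov_deriv_2 G T x a b c =
    partial_deriv a (\<lambda>y. T y b c) x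
      - (\<Sum>e\<in>UNIV. complex_of_real (christoffel G x e a b) * T x e c)
      - (\<Sum>e\<in>UNIV. complex_of_real (christoffel G x e a c) * T x b e)"

definition riemann_up ::
    "(real^'n::finite \<Rightarrow> real^'n^'n) \<Rightarrow> real^'n \<Rightarrow> 'n \<Rightarrow> 'n \<Rightarrow> 'n \<Rightarrow> 'n \<Rightarrow> real"
  where "riemann_up G x a b c d =
    partial_deriv c (\<lambda>y. christoffel G y a b d) x - partial_deriv d (\<lambda>y. christoffel G y a b c) x
      + (\<Sum>e\<in>UNIV. christoffel G x a e c * christoffel G x e b d)
      - (\<Sum>e\<in>UNIV. christoffel G x a e d * christoffel G x e b c)"

definition riemann ::
    "(real^'n::finite \<Rightarrow> real^'n^'n) \<Rightarrow> real^'n \<Rightarrow> 'n \<Rightarrow> 'n \<Rightarrow> 'n \<Rightarrow> 'n \<Rightarrow> real"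
  where "riemann G x a b c d = (\<Sum>e\<in>UNIV. G x $ a $ e * riemann_up G x e b c d)"

definition F_tensor ::
    "(real^'n::finite \<Rightarrow> real^'n^'n) \<Rightarrow> (real^'n \<Rightarrow> complex^'n) \<Rightarrow> real^'n \<Rightarrow> 'n \<Rightarrow> 'n \<Rightarrow> complex"
  where "F_tensor G \<omega> x a b = cov_deriv_1 G \<omega> x a b - cov_deriv_1 G \<omega> x b a"

definition S_tensor ::
    "(real^'n::finite \<Rightarrow> real^'n^'n) \<Rightarrow> (real^'n \<Rightarrow> complex^'n) \<Rightarrow> real^'n \<Rightarrow> 'n \<Rightarrow> 'n \<Rightarrow> complex"
  where "S_tensor G \<omega> x a b = 1/2 * (cov_deriv_1 G \<omega> x a b + cov_deriv_1 G \<omega> x b a)"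

definition J_tensor ::
    "(real^'n::finite \<Rightarrow> real^'n^'n) \<Rightarrow> (real^'n \<Rightarrow> complex^'n)
      \<Rightarrow> real^'n \<Rightarrow> 'n \<Rightarrow> 'n \<Rightarrow> 'n \<Rightarrow> complex"
  where "J_tensor G \<omega> x a b c = cov_deriv_2 G (F_tensor G \<omega>) x a b c"

definition curvature_c ::
    "(real^'n::finite \<Rightarrow> real^'n^'n) \<Rightarrow> ('i::finite \<Rightarrow> real^'n \<Rightarrow> complex^'n)
      \<Rightarrow> real^'n \<Rightarrow> 'n \<Rightarrow> 'n \<Rightarrow> 'n \<Rightarrow> 'n \<Rightarrow> complex"
  where "curvature_c G A x a b c d =
    1/2 * ((\<lambda>I. A I x $ a) \<odot> (\<lambda>I. J_tensor G (A I) x b c d)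
         - (\<lambda>I. A I x $ b) \<odot> (\<lambda>I. J_tensor G (A I) x a c d)
         + (\<lambda>I. A I x $ c) \<odot> (\<lambda>I. J_tensor G (A I) x d a b)
         - (\<lambda>I. A I x $ d) \<odot> (\<lambda>I. J_tensor G (A I) x c a b))"

definition curvature_f ::
    "(real^'n::finite \<Rightarrow> real^'n^'n) \<Rightarrow> ('i::finite \<Rightarrow> real^'n \<Rightarrow> complex^'n)
      \<Rightarrow> real^'n \<Rightarrow> 'n \<Rightarrow> 'n \<Rightarrow> 'n \<Rightarrow> 'n \<Rightarrow> complex"
  where "curvature_f G A x a b c d =
    1/4 * ((\<lambda>I. F_tensor G (A I) x a d) \<odot> (\<lambda>I. F_tensor G (A I) x b c)
         - (\<lambda>I. F_tensor G (A I) x a c) \<odot> (\<lambda>I. F_tensor G (A I) x b d)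
         - 2 * ((\<lambda>I. F_tensor G (A I) x a b) \<odot> (\<lambda>I. F_tensor G (A I) x c d)))"

definition curvature_s ::
    "(real^'n::finite \<Rightarrow> real^'n^'n) \<Rightarrow> ('i::finite \<Rightarrow> real^'n \<Rightarrow> complex^'n)
      \<Rightarrow> real^'n \<Rightarrow> 'n \<Rightarrow> 'n \<Rightarrow> 'n \<Rightarrow> 'n \<Rightarrow> complex"
  where "curvature_s G A x a b c d =
    (\<lambda>I. S_tensor G (A I) x a c) \<odot> (\<lambda>I. S_tensor G (A I) x b d)
      - (\<lambda>I. S_tensor G (A I) x a d) \<odot> (\<lambda>I. S_tensor G (A I) x b c)"

end

theory Submission
  imports Defs
begin

text \<open>
  The identity is local and tensorial, so it is proved in one fixed chart. Write \<open>D\<^sub>I\<^sub>a\<^sub>b\<close> for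
  \<open>\<nabla>\<^sub>a A\<^sub>I\<^sub>b\<close> and \<open>DD\<^sub>I\<^sub>a\<^sub>b\<^sub>c\<close> for \<open>\<nabla>\<^sub>a \<nabla>\<^sub>b A\<^sub>I\<^sub>c\<close>. Two facts about these arrays carry the proof.

  The Ricci identity for the forms, contracted with \<open>A\<^sub>I\<^sub>a\<close>, turns the sum of
  \<open>A\<^sub>I\<^sub>a A\<^sub>I\<^sub>e\<close> into \<open>g\<^sub>a\<^sub>e\<close> and so expresses the curvature through second covariant derivatives:
  with \<open>T a b c d\<close> the sum over \<open>I\<close> of \<open>A\<^sub>I\<^sub>a DD\<^sub>I\<^sub>b\<^sub>c\<^sub>d\<close>, one has \<open>R a b c d = T a d c b - T a c d b\<close>
  (\<open>riemann_second_derivative\<close>).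

  Metric compatibility says that the sum of \<open>A\<^sub>I\<^sub>a D\<^sub>I\<^sub>c\<^sub>b + A\<^sub>I\<^sub>b D\<^sub>I\<^sub>c\<^sub>a\<close> vanishes. Its covariant
  derivative shows that \<open>T\<close> is antisymmetric in its first and last index up to products of two
  first derivatives (\<open>second_covariant_derivative_metric\<close>).

  The term \<open>R\<^sup>(\<^sup>c\<^sup>)\<close> is half a signed sum of eight values of \<open>T\<close>. Moving the undifferentiated
  form to the other end in four of them pairs the eight values into four commutators, that is into
  four components of the curvature. By the first Bianchi identity and the pair symmetry these add
  up to \<open>2 R a b c d\<close>. The products of first derivatives picked up on the way are, after
  splitting \<open>D = S + F / 2\<close>, exactly \<open>R\<^sup>(\<^sup>f\<^sup>)\<close> and \<open>R\<^sup>(\<^sup>s\<^sup>)\<close> (\<open>curvature_decomposition\<close>).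
\<close>

section \<open>Calculus of partial derivatives\<close>

lemma partial_deriv_eqI:
  "(f has_derivative f') (at x) \<Longrightarrow> partial_deriv a f x = f' (axis a 1)"
  unfolding partial_deriv_def using frechet_derivative_at by metis

lemma partial_deriv_const: "partial_deriv a (\<lambda>_. c) x = 0"
  by (rule partial_deriv_eqI[OF has_derivative_const, THEN trans]) simp

lemma partial_deriv_add:
  assumes "f differentiable (at x)" "g differentiable (at x)"
  shows "partial_deriv a (\<lambda>y. f y + g y) x = partial_deriv a f x + partial_deriv a g x"
  using partial_deriv_eqI[OF has_derivative_add[OF assms[unfolded frechet_derivative_works]], of a]
  by (simp add: partial_deriv_def)

lemma partial_deriv_diff:
  assumes "f differentiable (at x)" "g differentiable (at x)"
  shows "partial_deriv a (\<lambda>y. f y - g y) x = partial_deriv a f x - partial_deriv a g x"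
  using partial_deriv_eqI[OF has_derivative_diff[OF assms[unfolded frechet_derivative_works]], of a]
  by (simp add: partial_deriv_def)

lemma partial_deriv_sum:
  assumes "\<And>i. i \<in> I \<Longrightarrow> f i differentiable (at x)"
  shows "partial_deriv a (\<lambda>y. \<Sum>i\<in>I. f i y) x = (\<Sum>i\<in>I. partial_deriv a (f i) x)"
proof -
  have "((\<lambda>y. \<Sum>i\<in>I. f i y) has_derivative (\<lambda>h. \<Sum>i\<in>I. frechet_derivative (f i) (at x) h)) (at x)"
    using assms by (intro has_derivative_sum) (simp add: frechet_derivative_works)
  from partial_deriv_eqI[OF this, of a] show ?thesis
    by (simp add: partial_deriv_def)
qed

lemma partial_deriv_mult:
  fixes f g :: "real^'n::finite \<Rightarrow> 'b::real_normed_algebra"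
  assumes "f differentiable (at x)" "g differentiable (at x)"
  shows "partial_deriv a (\<lambda>y. f y * g y) x = partial_deriv a f x * g x + f x * partial_deriv a g x"
  using partial_deriv_eqI[OF has_derivative_mult[OF assms[unfolded frechet_derivative_works]], of a]
  by (simp add: partial_deriv_def add.commute)

lemma partial_deriv_bounded_linear:
  assumes "bounded_linear h" "f differentiable (at x)"
  shows "partial_deriv a (\<lambda>y. h (f y)) x = h (partial_deriv a f x)"
  using partial_deriv_eqI[OF bounded_linear.has_derivative[OF assms(1) assms(2)[unfolded frechet_derivative_works]], of a]
  by (simp add: partial_deriv_def)

lemma differentiable_bounded_linear:
  "bounded_linear h \<Longrightarrow> f differentiable (at x) \<Longrightarrow> (\<lambda>y. h (f y)) differentiable (at x)"
  unfolding differentiable_def by (blast dest: bounded_linear.has_derivative)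

lemma differentiable_cong_open:
  assumes "open S" "x \<in> S" "\<And>y. y \<in> S \<Longrightarrow> f y = g y" "f differentiable (at x)"
  shows "g differentiable (at x)"
  using assms has_derivative_transform_within_open unfolding differentiable_def by blast

lemma partial_deriv_cong_open:
  assumes "open S" "x \<in> S" "\<And>y. y \<in> S \<Longrightarrow> f y = g y" "f differentiable (at x)"
  shows "partial_deriv a f x = partial_deriv a g x"
  using partial_deriv_eqI[OF has_derivative_transform_within_open[OF assms(4)[unfolded frechet_derivative_works] assms(1-3)], of a]
  by (simp add: partial_deriv_def)

lemma has_real_derivative_partial_deriv:
  fixes f :: "real^'n::finite \<Rightarrow> real"
  assumes "f differentiable (at (p + s *\<^sub>R axis a 1))"
  shows "((\<lambda>s. f (p + s *\<^sub>R axis a 1)) has_real_derivative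
    partial_deriv a f (p + s *\<^sub>R axis a 1)) (at s)"
proof -
  let ?D = "frechet_derivative f (at (p + s *\<^sub>R axis a 1))"
  have D: "(f has_derivative ?D) (at (p + s *\<^sub>R axis a 1))"
    using assms by (simp add: frechet_derivative_works)
  have "((\<lambda>s. p + s *\<^sub>R axis a 1) has_derivative (\<lambda>h. h *\<^sub>R axis a (1::real))) (at s)"
    by (auto intro!: derivative_eq_intros)
  from diff_chain_at[OF this D]
  have "((\<lambda>s. f (p + s *\<^sub>R axis a 1)) has_derivative (\<lambda>h. ?D (h *\<^sub>R axis a 1))) (at s)"
    by (simp add: o_def)
  moreover have "?D (h *\<^sub>R axis a 1) = partial_deriv a f (p + s *\<^sub>R axis a 1) * h" for h
    using linear_scale[OF has_derivative_linear[OF D]] by (simp add: partial_deriv_def)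
  ultimately show ?thesis
    by (simp add: has_field_derivative_def)
qed

section \<open>Symmetry of second partial derivatives\<close>

text \<open>The mean value theorem is applied first in the direction \<open>a\<close>, to the increment of \<open>f\<close> in the
  direction \<open>b\<close>, and then in the direction \<open>b\<close>. The left-hand side is symmetric in \<open>a\<close> and \<open>b\<close>, the
  order of differentiation on the right is not; this yields the symmetry of second derivatives.\<close>

lemma mixed_difference_mean_value:
  fixes f :: "real^'n::finite \<Rightarrow> real"
  assumes t: "0 < t" "2 * t < \<epsilon>"
    and f: "\<And>y. y \<in> ball x \<epsilon> \<Longrightarrow> f differentiable (at y)"
    and df: "\<And>y. y \<in> ball x \<epsilon> \<Longrightarrow> partial_deriv a f differentiable (at y)"
  obtains z where "z \<in> ball x \<epsilon>"
    "f (x + t *\<^sub>R axis a 1 + t *\<^sub>R axis b 1) - f (x + t *\<^sub>R axis a 1)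
      - f (x + t *\<^sub>R axis b 1) + f x = t\<^sup>2 * partial_deriv b (partial_deriv a f) z"
proof -
  have near: "x + s *\<^sub>R axis a 1 + u *\<^sub>R axis b 1 \<in> ball x \<epsilon>" if "0 \<le> s" "s \<le> t" "0 \<le> u" "u \<le> t" for s u
  proof -
    have "norm (s *\<^sub>R axis a 1 + u *\<^sub>R axis b 1 :: real^'n) \<le> s + u"
      by (rule norm_triangle_le) (use that in \<open>simp add: norm_axis_1\<close>)
    then have "dist (x + (s *\<^sub>R axis a 1 + u *\<^sub>R axis b 1)) x < \<epsilon>"
      using t that by (simp add: dist_norm)
    then show ?thesis
      by (simp add: add.assoc dist_commute)
  qed
  define \<phi> where "\<phi> s = f (x + s *\<^sub>R axis a 1 + t *\<^sub>R axis b 1) - f (x + s *\<^sub>R axis a 1)" for s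
  have "\<exists>s. 0 < s \<and> s < t \<and> \<phi> t - \<phi> 0 = (t - 0) *
    (partial_deriv a f (x + s *\<^sub>R axis a 1 + t *\<^sub>R axis b 1) - partial_deriv a f (x + s *\<^sub>R axis a 1))"
  proof (rule MVT2[OF t(1)])
    fix s :: real assume s: "0 \<le> s" "s \<le> t"
    have swap: "x + t *\<^sub>R axis b 1 + s *\<^sub>R axis a 1 = x + s *\<^sub>R axis a 1 + t *\<^sub>R axis b 1" for s
      by (simp add: ac_simps)
    show "(\<phi> has_real_derivative partial_deriv a f (x + s *\<^sub>R axis a 1 + t *\<^sub>R axis b 1)
        - partial_deriv a f (x + s *\<^sub>R axis a 1)) (at s)"
      unfolding \<phi>_def
      using has_real_derivative_partial_deriv[of f "x + t *\<^sub>R axis b 1" s a, unfolded swap]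
        has_real_derivative_partial_deriv[of f x s a] near[OF s, of t] near[OF s, of 0] t f
      by (intro DERIV_diff) auto
  qed
  then obtain s where s: "0 < s" "s < t" and \<phi>: "\<phi> t - \<phi> 0 = t *
    (partial_deriv a f (x + s *\<^sub>R axis a 1 + t *\<^sub>R axis b 1) - partial_deriv a f (x + s *\<^sub>R axis a 1))"
    by auto
  let ?p = "x + s *\<^sub>R axis a 1"
  have "\<exists>u. 0 < u \<and> u < t \<and> partial_deriv a f (?p + t *\<^sub>R axis b 1) - partial_deriv a f (?p + 0 *\<^sub>R axis b 1)
    = (t - 0) * partial_deriv b (partial_deriv a f) (?p + u *\<^sub>R axis b 1)"
    by (rule MVT2[OF t(1)]) (use near s in \<open>auto intro!: has_real_derivative_partial_deriv df\<close>)
  then obtain u where u: "0 < u" "u < t"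
    and "partial_deriv a f (?p + t *\<^sub>R axis b 1) - partial_deriv a f ?p
      = t * partial_deriv b (partial_deriv a f) (?p + u *\<^sub>R axis b 1)"
    by auto
  with \<phi> have "f (x + t *\<^sub>R axis a 1 + t *\<^sub>R axis b 1) - f (x + t *\<^sub>R axis a 1)
      - f (x + t *\<^sub>R axis b 1) + f x = t\<^sup>2 * partial_deriv b (partial_deriv a f) (?p + u *\<^sub>R axis b 1)"
    by (simp add: \<phi>_def power2_eq_square)
  moreover have "?p + u *\<^sub>R axis b 1 \<in> ball x \<epsilon>"
    using s u by (intro near) auto
  ultimately show thesis
    using that by blast
qed

lemma Ck_on_cong:
  assumes "open S" "\<And>y. y \<in> S \<Longrightarrow> f y = g y" "Ck_on k f S"
  shows "Ck_on k g S"
  using assms(2,3)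
proof (induction k arbitrary: f g)
  case 0
  then show ?case
    using continuous_on_cong[of S S f g] by simp
next
  case (Suc k)
  have f: "f differentiable (at y)" if "y \<in> S" for y
    using Suc.prems(2) that \<open>open S\<close> by (simp add: differentiable_on_eq_differentiable_at)
  have "g differentiable_on S"
    unfolding differentiable_on_eq_differentiable_at[OF \<open>open S\<close>]
    using differentiable_cong_open[OF \<open>open S\<close> _ Suc.prems(1) f] by blast
  moreover have "Ck_on k (partial_deriv a g) S" for a
    using Suc.IH[of "partial_deriv a f" "partial_deriv a g"] Suc.prems(2)
      partial_deriv_cong_open[OF \<open>open S\<close> _ Suc.prems(1) f] by simp
  ultimately show ?case
    by simp
qed

lemma Ck_on_bounded_linear:
  assumes "open S" "bounded_linear h" "Ck_on k f S"
  shows "Ck_on k (\<lambda>y. h (f y)) S"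
  using assms(3)
proof (induction k arbitrary: f)
  case 0
  then show ?case
    using bounded_linear.continuous_on[OF assms(2)] by simp
next
  case (Suc k)
  have f: "f differentiable (at y)" if "y \<in> S" for y
    using Suc.prems that \<open>open S\<close> by (simp add: differentiable_on_eq_differentiable_at)
  have "(\<lambda>y. h (f y)) differentiable_on S"
    unfolding differentiable_on_eq_differentiable_at[OF \<open>open S\<close>]
    using differentiable_bounded_linear[OF assms(2) f] by blast
  moreover have "Ck_on k (partial_deriv a (\<lambda>y. h (f y))) S" for a
    by (rule Ck_on_cong[OF \<open>open S\<close> _ Suc.IH])
      (use Suc.prems partial_deriv_bounded_linear[OF assms(2) f] in auto)
  ultimately show ?case
    by simp
qed

lemma Ck_on_2D:
  assumes "open S" "Ck_on 2 f S" "y \<in> S"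
  shows "f differentiable (at y)" "partial_deriv c f differentiable (at y)"
    "isCont (partial_deriv d (partial_deriv c f)) y"
  using assms by (auto simp: numeral_2_eq_2 differentiable_on_eq_differentiable_at continuous_on_eq_continuous_at)

text \<open>If the two mixed derivatives differed at \<open>x\<close>, then by continuity they would take no common
  value near \<open>x\<close>, whereas the mixed second difference of a small square is a value of both.\<close>

lemma partial_deriv_commute_real:
  fixes f :: "real^'n::finite \<Rightarrow> real"
  assumes S: "open S" "x \<in> S" and C2: "Ck_on 2 f S"
  shows "partial_deriv a (partial_deriv b f) x = partial_deriv b (partial_deriv a f) x" (is "?h x = ?k x")
proof (rule ccontr)
  assume neq: "?h x \<noteq> ?k x"
  define e where "e = \<bar>?h x - ?k x\<bar> / 2"
  have e: "e > 0"
    using neq by (simp add: e_def)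
  obtain r where r: "r > 0" "ball x r \<subseteq> S"
    using S by (meson open_contains_ball)
  obtain r1 where r1: "r1 > 0" "\<And>y. dist x y < r1 \<Longrightarrow> dist (?h x) (?h y) < e"
    using Ck_on_2D(3)[OF S(1) C2 S(2), of a b] e unfolding continuous_at_eps_delta by (metis dist_commute)
  obtain r2 where r2: "r2 > 0" "\<And>y. dist x y < r2 \<Longrightarrow> dist (?k x) (?k y) < e"
    using Ck_on_2D(3)[OF S(1) C2 S(2), of b a] e unfolding continuous_at_eps_delta by (metis dist_commute)
  define \<epsilon> where "\<epsilon> = min r (min r1 r2)"
  define t where "t = \<epsilon> / 3"
  have t: "0 < t" "2 * t < \<epsilon>"
    using r r1 r2 by (auto simp: t_def \<epsilon>_def)
  have *: "y \<in> S" "dist x y < r1" "dist x y < r2" if "y \<in> ball x \<epsilon>" for y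
    using that r by (auto simp: \<epsilon>_def)
  obtain z where z: "z \<in> ball x \<epsilon>"
    "f (x + t *\<^sub>R axis a 1 + t *\<^sub>R axis b 1) - f (x + t *\<^sub>R axis a 1)
      - f (x + t *\<^sub>R axis b 1) + f x = t\<^sup>2 * ?k z"
    using mixed_difference_mean_value[OF t, of x f a b] Ck_on_2D[OF S(1) C2] *(1) by blast
  obtain w where w: "w \<in> ball x \<epsilon>"
    "f (x + t *\<^sub>R axis b 1 + t *\<^sub>R axis a 1) - f (x + t *\<^sub>R axis b 1)
      - f (x + t *\<^sub>R axis a 1) + f x = t\<^sup>2 * ?h w"
    using mixed_difference_mean_value[OF t, of x f b a] Ck_on_2D[OF S(1) C2] *(1) by blast
  have "t\<^sup>2 * ?k z = t\<^sup>2 * ?h w"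
    unfolding z(2)[symmetric] w(2)[symmetric] by (simp add: ac_simps)
  then have "?k z = ?h w"
    using t by simp
  moreover have "dist (?h x) (?h w) < e" "dist (?k x) (?k z) < e"
    using r1(2) r2(2) * z(1) w(1) by blast+
  ultimately show False
    unfolding e_def dist_real_def by argo
qed

text \<open>The real case is applied to the inner product of \<open>f\<close> with the difference \<open>v\<close> of the two mixed
  derivatives; it gives \<open>v \<bullet> v = 0\<close>. The case needed below is that of complex values.\<close>

lemma partial_deriv_commute:
  fixes f :: "real^'n::finite \<Rightarrow> 'b::real_inner"
  assumes S: "open S" "x \<in> S" and C2: "Ck_on 2 f S"
  shows "partial_deriv a (partial_deriv b f) x = partial_deriv b (partial_deriv a f) x"
proof -
  define v where "v = partial_deriv a (partial_deriv b f) x - partial_deriv b (partial_deriv a f) x"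
  let ?h = "\<lambda>u::'b. u \<bullet> v"
  have h: "bounded_linear ?h"
    by (rule bounded_linear_inner_left)
  have second: "partial_deriv d (partial_deriv c (\<lambda>y. ?h (f y))) x = ?h (partial_deriv d (partial_deriv c f) x)" for c d
  proof -
    have "partial_deriv d (\<lambda>y. ?h (partial_deriv c f y)) x = partial_deriv d (partial_deriv c (\<lambda>y. ?h (f y))) x"
      by (rule partial_deriv_cong_open[OF S])
        (use Ck_on_2D[OF S(1) C2] S in
          \<open>simp_all add: partial_deriv_bounded_linear[OF h] differentiable_bounded_linear[OF h]\<close>)
    then show ?thesis
      using partial_deriv_bounded_linear[OF h Ck_on_2D(2)[OF S(1) C2 S(2)]] by simp
  qed
  have "v \<bullet> v = 0"
    using partial_deriv_commute_real[OF S Ck_on_bounded_linear[OF S(1) h C2], of a b]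
    unfolding second by (simp add: v_def inner_diff_left)
  then show ?thesis
    by (simp add: v_def)
qed


section \<open>Differentiability of the inverse matrix\<close>

lemma differentiable_sum_at:
  assumes "\<And>i. i \<in> I \<Longrightarrow> f i differentiable (at x)"
  shows "(\<lambda>y. \<Sum>i\<in>I. f i y) differentiable (at x)"
  using assms by (induction I rule: infinite_finite_induct) auto

lemma differentiable_prod_at:
  fixes f :: "'i \<Rightarrow> 'a::real_normed_vector \<Rightarrow> real"
  assumes "\<And>i. i \<in> I \<Longrightarrow> f i differentiable (at x)"
  shows "(\<lambda>y. \<Prod>i\<in>I. f i y) differentiable (at x)"
  using assms by (induction I rule: infinite_finite_induct) auto

lemma differentiable_det:
  fixes M :: "'a::real_normed_vector \<Rightarrow> real^'n::finite^'n"
  assumes "\<And>i j. (\<lambda>y. M y $ i $ j) differentiable (at x)"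
  shows "(\<lambda>y. det (M y)) differentiable (at x)"
  unfolding det_def
  by (intro differentiable_sum_at differentiable_mult differentiable_prod_at assms) simp

lemma matrix_mult_matrix_inv:
  fixes M :: "real^'n::finite^'n"
  assumes "det M \<noteq> 0"
  shows "M ** matrix_inv M = mat 1"
  using assms someI_ex[of "\<lambda>N. M ** N = mat 1 \<and> N ** M = mat 1"]
  unfolding invertible_det_nz[symmetric] invertible_def matrix_inv_def by blast

text \<open>Cramer's rule presents the entries of the inverse as quotients of polynomials in the entries
  of the matrix; this is how the Christoffel symbols are seen to be differentiable.\<close>

lemma matrix_inv_component:
  fixes M :: "real^'n::finite^'n"
  assumes "det M \<noteq> 0"
  shows "matrix_inv M $ c $ d = det (\<chi> i j. if j = c then axis d 1 $ i else M $ i $ j) / det M"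
proof -
  have "M *v (matrix_inv M *v axis d 1) = axis d 1"
    using matrix_mult_matrix_inv[OF assms] by (simp add: matrix_vector_mul_assoc)
  then have "matrix_inv M *v axis d 1 = (\<chi> k. det (\<chi> i j. if j = k then axis d 1 $ i else M $ i $ j) / det M)"
    by (rule iffD1[OF cramer[OF assms]])
  then have "(matrix_inv M *v axis d 1) $ c = (\<chi> k. det (\<chi> i j. if j = k then axis d 1 $ i else M $ i $ j) / det M) $ c"
    by simp
  then show ?thesis
    by (simp add: matrix_vector_mult_basis column_def)
qed

lemma differentiable_matrix_inv:
  fixes M :: "'a::real_normed_vector \<Rightarrow> real^'n::finite^'n"
  assumes S: "open S" "x \<in> S" and det: "\<And>y. y \<in> S \<Longrightarrow> det (M y) \<noteq> 0"
    and M: "\<And>i j. (\<lambda>y. M y $ i $ j) differentiable (at x)"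
  shows "(\<lambda>y. matrix_inv (M y) $ c $ d) differentiable (at x)"
proof (rule differentiable_cong_open[OF S])
  show "det (\<chi> i j. if j = c then axis d 1 $ i else M y $ i $ j) / det (M y) = matrix_inv (M y) $ c $ d"
    if "y \<in> S" for y
    using matrix_inv_component[OF det[OF that]] by simp
  show "(\<lambda>y. det (\<chi> i j. if j = c then axis d 1 $ i else M y $ i $ j) / det (M y)) differentiable (at x)"
  proof (rule differentiable_divide[OF differentiable_det differentiable_det[OF M] det[OF S(2)]])
    fix i j
    show "(\<lambda>y. (\<chi> i j. if j = c then axis d 1 $ i else M y $ i $ j) $ i $ j) differentiable (at x)"
      using M by (cases "j = c") simp_all
  qed
qed

lemma has_signature_det_nonzero:
  fixes G :: "real^'n::finite^'n"
  assumes "has_signature G r"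
  shows "det G \<noteq> 0"
proof -
  obtain B :: "real^'n^'n" and P where
    eq: "transpose B ** G ** B = (\<chi> a b. if a = b then (if a \<in> P then 1 else - 1) else 0)"
    using assms unfolding has_signature_def by blast
  have "det (transpose B ** G ** B) = (\<Prod>i\<in>UNIV. if i \<in> P then 1 else - 1)"
    unfolding eq by (subst det_diagonal) auto
  also have "\<dots> \<noteq> 0"
    by auto
  finally show ?thesis
    by (auto simp: det_mul)
qed

section \<open>The Levi-Civita connection and the curvature in one chart\<close>

locale metric_components =
  fixes S :: "(real^'n::finite) set" and G :: "real^'n \<Rightarrow> real^'n^'n"
  assumes open_domain: "open S"
    and metric_C2: "Ck_on 2 G S"
    and metric_symmetric: "y \<in> S \<Longrightarrow> G y $ a $ b = G y $ b $ a"
    and metric_nondegenerate: "y \<in> S \<Longrightarrow> det (G y) \<noteq> 0"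
begin

lemma metric_component_C2: "Ck_on 2 (\<lambda>y. G y $ a $ b) S"
proof -
  have "bounded_linear (\<lambda>M::real^'n^'n. M $ a $ b)"
    using bounded_linear_compose[OF bounded_linear_vec_nth bounded_linear_vec_nth] .
  from Ck_on_bounded_linear[OF open_domain this metric_C2] show ?thesis .
qed

lemmas metric_differentiable = Ck_on_2D(1,2)[OF open_domain metric_component_C2]

lemma metric_derivative_symmetric:
  assumes "y \<in> S"
  shows "partial_deriv c (\<lambda>y. G y $ a $ b) y = partial_deriv c (\<lambda>y. G y $ b $ a) y"
  by (rule partial_deriv_cong_open[OF open_domain assms])
    (simp_all add: metric_symmetric[of _ a b] metric_differentiable(1)[OF assms])

lemma christoffel_symmetric:
  assumes "y \<in> S"
  shows "christoffel G y c a b = christoffel G y c b a"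
  unfolding christoffel_def metric_derivative_symmetric[OF assms, of _ a b] by (simp add: add.commute)

lemma christoffel_differentiable:
  assumes "y \<in> S"
  shows "(\<lambda>y. christoffel G y c a b) differentiable (at y)"
  unfolding christoffel_def
  by (rule differentiable_mult differentiable_sum_at differentiable_const differentiable_diff
      differentiable_add metric_differentiable[OF assms] differentiable_matrix_inv[OF open_domain assms]
      metric_nondegenerate | assumption)+

text \<open>Lowering the upper index removes the inverse metric, so that later identities about the
  Christoffel symbols are linear in the derivatives of the metric.\<close>

lemma lowered_christoffel:
  assumes "y \<in> S"
  shows "(\<Sum>c\<in>UNIV. G y $ e $ c * christoffel G y c a b) =
    1/2 * (partial_deriv a (\<lambda>y. G y $ e $ b) y + partial_deriv b (\<lambda>y. G y $ e $ a) y
      - partial_deriv e (\<lambda>y. G y $ a $ b) y)"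
proof -
  define K where "K d = partial_deriv a (\<lambda>y. G y $ d $ b) y + partial_deriv b (\<lambda>y. G y $ d $ a) y
      - partial_deriv d (\<lambda>y. G y $ a $ b) y" for d
  have "G y ** matrix_inv (G y) = mat 1"
    by (rule matrix_mult_matrix_inv[OF metric_nondegenerate[OF assms]])
  then have inv: "(\<Sum>c\<in>UNIV. G y $ e $ c * matrix_inv (G y) $ c $ d) = (if e = d then 1 else 0)" for d
    by (simp add: vec_eq_iff matrix_matrix_mult_def mat_def)
  have "(\<Sum>c\<in>UNIV. G y $ e $ c * christoffel G y c a b)
      = 1/2 * (\<Sum>c\<in>UNIV. \<Sum>d\<in>UNIV. G y $ e $ c * matrix_inv (G y) $ c $ d * K d)"
    by (simp add: christoffel_def K_def sum_distrib_left mult_ac)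
  also have "\<dots> = 1/2 * (\<Sum>d\<in>UNIV. (\<Sum>c\<in>UNIV. G y $ e $ c * matrix_inv (G y) $ c $ d) * K d)"
    by (subst sum.swap) (simp add: sum_distrib_right)
  also have "\<dots> = 1/2 * K e"
    by (simp add: inv if_distrib[of "\<lambda>u. u * _"] cong: if_cong)
  finally show ?thesis
    by (simp add: K_def)
qed

lemma metric_derivative_christoffel:
  assumes "y \<in> S"
  shows "partial_deriv c (\<lambda>y. G y $ a $ b) y =
    (\<Sum>e\<in>UNIV. G y $ a $ e * christoffel G y e c b) + (\<Sum>e\<in>UNIV. G y $ b $ e * christoffel G y e c a)"
  unfolding lowered_christoffel[OF assms]
  using metric_derivative_symmetric[OF assms, of c a b] metric_derivative_symmetric[OF assms, of b a c]
    metric_derivative_symmetric[OF assms, of a b c]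
  by (simp add: field_simps)

lemma riemann_antisymmetric: "riemann G x a b c d = - riemann G x a b d c"
proof -
  have "riemann_up G x e b c d = - riemann_up G x e b d c" for e
    unfolding riemann_up_def by simp
  then show ?thesis
    unfolding riemann_def by (simp add: sum_negf)
qed

text \<open>The Christoffel symbols are symmetric in the lower indices, so each term of one summand is
  cancelled by a term of another one under the cyclic permutation.\<close>

lemma riemann_bianchi:
  assumes "x \<in> S"
  shows "riemann G x a b c d + riemann G x a c d b + riemann G x a d b c = 0"
proof -
  have pd: "partial_deriv c (\<lambda>y. christoffel G y e a b) x = partial_deriv c (\<lambda>y. christoffel G y e b a) x" for a b c e
    by (rule partial_deriv_cong_open[OF open_domain assms])
      (simp_all add: christoffel_symmetric[of _ e a b] christoffel_differentiable[OF assms])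
  have "riemann_up G x e b c d + riemann_up G x e c d b + riemann_up G x e d b c = 0" for e
    unfolding riemann_up_def
      pd[of _ e b d] pd[of _ e b c] pd[of _ e c d]
      christoffel_symmetric[OF assms, of _ b d] christoffel_symmetric[OF assms, of _ b c]
      christoffel_symmetric[OF assms, of _ c d]
    by simp
  then show ?thesis
    unfolding riemann_def sum.distrib[symmetric] distrib_left[symmetric] by simp
qed

end

section \<open>Second covariant derivatives of the factorizing forms\<close>

lemma sum_mult_sum_swap:
  fixes u :: "'i \<Rightarrow> 'a::comm_semiring_0"
  shows "(\<Sum>I\<in>X. u I * (\<Sum>e\<in>Y. k e * v I e)) = (\<Sum>e\<in>Y. k e * (\<Sum>I\<in>X. u I * v I e))"
  unfolding sum_distrib_left by (subst sum.swap) (simp add: mult.left_commute)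

locale metric_factorization = metric_components S G
  for S :: "(real^'n::finite) set" and G :: "real^'n \<Rightarrow> real^'n^'n" +
  fixes A :: "'i::finite \<Rightarrow> real^'n \<Rightarrow> complex^'n"
  assumes forms_C2: "Ck_on 2 (A I) S"
    and metric_factorized: "y \<in> S \<Longrightarrow> complex_of_real (G y $ a $ b) = (\<Sum>I\<in>UNIV. A I y $ a * A I y $ b)"
begin

abbreviation \<Gamma> :: "real^'n \<Rightarrow> 'n \<Rightarrow> 'n \<Rightarrow> 'n \<Rightarrow> complex"
  where "\<Gamma> y c a b \<equiv> complex_of_real (christoffel G y c a b)"

abbreviation D :: "'i \<Rightarrow> real^'n \<Rightarrow> 'n \<Rightarrow> 'n \<Rightarrow> complex"
  where "D I \<equiv> cov_deriv_1 G (A I)"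

abbreviation DD :: "'i \<Rightarrow> real^'n \<Rightarrow> 'n \<Rightarrow> 'n \<Rightarrow> 'n \<Rightarrow> complex"
  where "DD I \<equiv> cov_deriv_2 G (cov_deriv_1 G (A I))"

lemma form_component_C2: "Ck_on 2 (\<lambda>y. A I y $ a) S"
  by (rule Ck_on_bounded_linear[OF open_domain bounded_linear_vec_nth forms_C2])

lemmas form_differentiable = Ck_on_2D(1,2)[OF open_domain form_component_C2]

lemma christoffel_complex_differentiable:
  "y \<in> S \<Longrightarrow> (\<lambda>y. \<Gamma> y c a b) differentiable (at y)"
  by (rule differentiable_bounded_linear[OF bounded_linear_of_real christoffel_differentiable])

lemma partial_deriv_christoffel_complex:
  "y \<in> S \<Longrightarrow> partial_deriv d (\<lambda>y. \<Gamma> y c a b) y = complex_of_real (partial_deriv d (\<lambda>y. christoffel G y c a b) y)"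
  by (rule partial_deriv_bounded_linear[OF bounded_linear_of_real christoffel_differentiable])

lemma christoffel_form_differentiable:
  "y \<in> S \<Longrightarrow> (\<lambda>y. \<Sum>e\<in>UNIV. \<Gamma> y e a b * A I y $ e) differentiable (at y)"
  by (intro differentiable_sum_at differentiable_mult christoffel_complex_differentiable form_differentiable)

lemma D_differentiable: "y \<in> S \<Longrightarrow> (\<lambda>y. D I y a b) differentiable (at y)"
  unfolding cov_deriv_1_def
  by (intro differentiable_diff form_differentiable christoffel_form_differentiable)

lemma partial_deriv_D:
  assumes "y \<in> S"
  shows "partial_deriv c (\<lambda>y. D I y a b) y = partial_deriv c (partial_deriv a (\<lambda>y. A I y $ b)) y
    - (\<Sum>e\<in>UNIV. complex_of_real (partial_deriv c (\<lambda>y. christoffel G y e a b) y) * A I y $ e)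
    - (\<Sum>e\<in>UNIV. \<Gamma> y e a b * partial_deriv c (\<lambda>y. A I y $ e) y)"
  unfolding cov_deriv_1_def
  by (simp add: partial_deriv_diff form_differentiable christoffel_form_differentiable partial_deriv_sum
      partial_deriv_mult christoffel_complex_differentiable partial_deriv_christoffel_complex assms
      sum.distrib)

text \<open>This is \<open>\<nabla>g = 0\<close> written through the factorization: the partial derivative of
  \<open>g\<^sub>a\<^sub>b\<close> is expanded by the product rule on one side and by Christoffel symbols on the other.\<close>

lemma covariant_derivative_metric:
  assumes "y \<in> S"
  shows "(\<Sum>I\<in>UNIV. A I y $ a * D I y c b + A I y $ b * D I y c a) = 0"
proof -
  have pd: "partial_deriv c (\<lambda>y. A I y $ a) y = D I y c a + (\<Sum>e\<in>UNIV. \<Gamma> y e c a * A I y $ e)" for I a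
    by (simp add: cov_deriv_1_def)
  have G: "(\<Sum>I\<in>UNIV. A I y $ a * (\<Sum>e\<in>UNIV. \<Gamma> y e c b * A I y $ e))
      = complex_of_real (\<Sum>e\<in>UNIV. G y $ a $ e * christoffel G y e c b)" for a b
    by (subst sum_mult_sum_swap) (simp add: metric_factorized[OF assms] mult.commute)
  have "complex_of_real (partial_deriv c (\<lambda>y. G y $ a $ b) y) = partial_deriv c (\<lambda>y. complex_of_real (G y $ a $ b)) y"
    using partial_deriv_bounded_linear[OF bounded_linear_of_real metric_differentiable(1)[OF assms]] by metis
  also have "\<dots> = partial_deriv c (\<lambda>y. \<Sum>I\<in>UNIV. A I y $ a * A I y $ b) y"
    by (rule partial_deriv_cong_open[OF open_domain assms])
      (simp_all add: metric_factorized differentiable_bounded_linear[OF bounded_linear_of_real]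
        metric_differentiable(1)[OF assms])
  also have "\<dots> = (\<Sum>I\<in>UNIV. partial_deriv c (\<lambda>y. A I y $ a) y * A I y $ b + A I y $ a * partial_deriv c (\<lambda>y. A I y $ b) y)"
    by (simp add: partial_deriv_sum partial_deriv_mult form_differentiable assms)
  also have "\<dots> = (\<Sum>I\<in>UNIV. A I y $ a * D I y c b + A I y $ b * D I y c a)
      + ((\<Sum>I\<in>UNIV. A I y $ a * (\<Sum>e\<in>UNIV. \<Gamma> y e c b * A I y $ e))
      + (\<Sum>I\<in>UNIV. A I y $ b * (\<Sum>e\<in>UNIV. \<Gamma> y e c a * A I y $ e)))"
    unfolding pd sum.distrib[symmetric] by (rule sum.cong) (simp_all add: distrib_left distrib_right mult.commute add_ac)
  also have "\<dots> = (\<Sum>I\<in>UNIV. A I y $ a * D I y c b + A I y $ b * D I y c a)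
      + complex_of_real (partial_deriv c (\<lambda>y. G y $ a $ b) y)"
    unfolding G metric_derivative_christoffel[OF assms] by simp
  finally show ?thesis
    by simp
qed

text \<open>This is \<open>\<nabla>\<nabla>g = 0\<close>. The partial derivative of the vanishing tensor \<open>\<nabla>g\<close> differs from the
  covariant one by contractions of Christoffel symbols with \<open>\<nabla>g\<close> itself, one for each of its
  three indices, and these vanish too.\<close>

lemma second_covariant_derivative_metric:
  assumes x: "x \<in> S"
  shows "(\<Sum>I\<in>UNIV. A I x $ a * DD I x d c b) + (\<Sum>I\<in>UNIV. A I x $ b * DD I x d c a)
    + (\<Sum>I\<in>UNIV. D I x d a * D I x c b) + (\<Sum>I\<in>UNIV. D I x d b * D I x c a) = 0"
proof -
  have pdA: "partial_deriv d (\<lambda>y. A I y $ a) x = D I x d a + (\<Sum>e\<in>UNIV. \<Gamma> x e d a * A I x $ e)" for I a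
    by (simp add: cov_deriv_1_def)
  have pdD: "partial_deriv d (\<lambda>y. D I y c b) x = DD I x d c b
      + (\<Sum>e\<in>UNIV. \<Gamma> x e d c * D I x e b) + (\<Sum>e\<in>UNIV. \<Gamma> x e d b * D I x c e)" for I b
    by (simp add: cov_deriv_2_def)
  \<comment> \<open>Each correction term is a contraction with \<open>\<nabla>g\<close>, which is the sum over \<open>I\<close> of \<open>v I e\<close>.\<close>
  have corr: "(\<Sum>I\<in>UNIV. \<Sum>e\<in>UNIV. k e * v I e) = 0" if "\<And>e. (\<Sum>I\<in>UNIV. v I e) = 0"
    for k :: "'n \<Rightarrow> complex" and v :: "'i \<Rightarrow> 'n \<Rightarrow> complex"
    by (subst sum.swap) (simp add: sum_distrib_left[symmetric] that)
  have "0 = partial_deriv d (\<lambda>y. 0::complex) x"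
    by (simp add: partial_deriv_const)
  also have "\<dots> = partial_deriv d (\<lambda>y. \<Sum>I\<in>UNIV. A I y $ a * D I y c b + A I y $ b * D I y c a) x"
    by (rule partial_deriv_cong_open[OF open_domain x]) (simp_all add: covariant_derivative_metric)
  also have "\<dots> = (\<Sum>I\<in>UNIV. partial_deriv d (\<lambda>y. A I y $ a) x * D I x c b + A I x $ a * partial_deriv d (\<lambda>y. D I y c b) x
      + (partial_deriv d (\<lambda>y. A I y $ b) x * D I x c a + A I x $ b * partial_deriv d (\<lambda>y. D I y c a) x))"
    by (simp add: partial_deriv_sum partial_deriv_add partial_deriv_mult form_differentiable D_differentiable x)
  also have "\<dots> = (\<Sum>I\<in>UNIV. (A I x $ a * DD I x d c b + A I x $ b * DD I x d c a
        + D I x d a * D I x c b + D I x d b * D I x c a)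
      + ((\<Sum>e\<in>UNIV. \<Gamma> x e d a * (A I x $ e * D I x c b + A I x $ b * D I x c e))
      + (\<Sum>e\<in>UNIV. \<Gamma> x e d b * (A I x $ e * D I x c a + A I x $ a * D I x c e))
      + (\<Sum>e\<in>UNIV. \<Gamma> x e d c * (A I x $ a * D I x e b + A I x $ b * D I x e a))))"
    unfolding pdA pdD
    by (intro sum.cong refl)
      (simp add: distrib_left distrib_right sum.distrib sum_distrib_left sum_distrib_right mult_ac)
  also have "\<dots> = (\<Sum>I\<in>UNIV. A I x $ a * DD I x d c b + A I x $ b * DD I x d c a
        + D I x d a * D I x c b + D I x d b * D I x c a)"
    by (simp only: sum.distrib corr[OF covariant_derivative_metric[OF x]] add_0_right)
  finally show ?thesis
    by (simp add: sum.distrib)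
qed

text \<open>Second partial derivatives of the form and the terms with its first derivatives are symmetric
  in \<open>c\<close> and \<open>d\<close> and drop out of the commutator. The derivatives and products of Christoffel
  symbols that remain are the definition of the curvature.\<close>

lemma ricci_identity:
  assumes x: "x \<in> S"
  shows "DD I x d c b - DD I x c d b = (\<Sum>e\<in>UNIV. complex_of_real (riemann_up G x e b c d) * A I x $ e)"
proof -
  have sym: "christoffel G x e a b = christoffel G x e b a" for e a b
    by (rule christoffel_symmetric[OF x])
  have pd: "partial_deriv c (\<lambda>y. christoffel G y e a b) x = partial_deriv c (\<lambda>y. christoffel G y e b a) x" for a b c e
    by (rule partial_deriv_cong_open[OF open_domain x])
      (simp_all add: christoffel_symmetric[of _ e a b] christoffel_differentiable[OF x])
  have commute: "partial_deriv c (partial_deriv d (\<lambda>y. A I y $ b)) x = partial_deriv d (partial_deriv c (\<lambda>y. A I y $ b)) x"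
    by (rule partial_deriv_commute[OF open_domain x form_component_C2])
  \<comment> \<open>The terms quadratic in the Christoffel symbols, brought to the index pattern used in the
    definition of the curvature.\<close>
  have swap: "(\<Sum>e\<in>UNIV. \<Gamma> x e c b * (\<Sum>f\<in>UNIV. \<Gamma> x f d e * A I x $ f))
    = (\<Sum>e\<in>UNIV. (\<Sum>f\<in>UNIV. \<Gamma> x e f d * \<Gamma> x f b c) * A I x $ e)" for c d
    unfolding sum_distrib_left sum_distrib_right
    by (subst sum.swap) (simp add: sym[of _ d] sym[of _ c b] mult_ac)
  have DD: "DD I x c d b = partial_deriv c (partial_deriv d (\<lambda>y. A I y $ b)) x
    - (\<Sum>e\<in>UNIV. complex_of_real (partial_deriv c (\<lambda>y. christoffel G y e b d) x) * A I x $ e)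
    - (\<Sum>e\<in>UNIV. \<Gamma> x e d b * partial_deriv c (\<lambda>y. A I y $ e) x)
    - (\<Sum>e\<in>UNIV. \<Gamma> x e c d * D I x e b)
    - (\<Sum>e\<in>UNIV. \<Gamma> x e c b * partial_deriv d (\<lambda>y. A I y $ e) x)
    + (\<Sum>e\<in>UNIV. (\<Sum>f\<in>UNIV. \<Gamma> x e f d * \<Gamma> x f b c) * A I x $ e)" for c d
  proof -
    have "(\<Sum>e\<in>UNIV. \<Gamma> x e c b * D I x d e) = (\<Sum>e\<in>UNIV. \<Gamma> x e c b * partial_deriv d (\<lambda>y. A I y $ e) x)
      - (\<Sum>e\<in>UNIV. (\<Sum>f\<in>UNIV. \<Gamma> x e f d * \<Gamma> x f b c) * A I x $ e)"
      unfolding swap[symmetric] cov_deriv_1_def by (simp add: right_diff_distrib sum_subtractf)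
    then show ?thesis
      unfolding cov_deriv_2_def partial_deriv_D[OF x] pd[of _ _ d b] by simp
  qed
  show ?thesis
    unfolding DD riemann_up_def commute sym[of _ d c]
    by (simp add: left_diff_distrib distrib_right sum.distrib sum_subtractf)
qed

text \<open>Contracting the Ricci identity with \<open>A I\<close> and summing over \<open>I\<close> lowers the upper index of the
  curvature, by the factorization of the metric.\<close>

lemma riemann_second_derivative:
  assumes x: "x \<in> S"
  shows "complex_of_real (riemann G x a b c d) =
    (\<Sum>I\<in>UNIV. A I x $ a * DD I x d c b) - (\<Sum>I\<in>UNIV. A I x $ a * DD I x c d b)"
  unfolding sum_subtractf[symmetric] right_diff_distrib[symmetric] ricci_identity[OF x] riemann_def
  by (subst sum_mult_sum_swap) (simp add: metric_factorized[OF x] mult.commute)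

lemma J_tensor_eq:
  assumes "x \<in> S"
  shows "J_tensor G (A I) x a b c = DD I x a b c - DD I x a c b"
  unfolding J_tensor_def cov_deriv_2_def F_tensor_def
  by (simp add: partial_deriv_diff D_differentiable assms right_diff_distrib sum_subtractf)

section \<open>Symmetries of the curvature and the decomposition\<close>

text \<open>The sum of \<open>R a b c d\<close> and \<open>R b a c d\<close> is \<open>\<nabla>\<nabla>g\<close> antisymmetrized in the two directions of
  differentiation, and the products of first derivatives are symmetric in these.\<close>

lemma riemann_antisymmetric_first_pair:
  assumes x: "x \<in> S"
  shows "riemann G x b a c d = - riemann G x a b c d"
proof -
  have "complex_of_real (riemann G x b a c d) = complex_of_real (- riemann G x a b c d)"
    using second_covariant_derivative_metric[OF x, of a d c b] second_covariant_derivative_metric[OF x, of a c d b]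
    by (simp add: riemann_second_derivative[OF x] mult.commute) algebra
  then show ?thesis
    by (simp only: of_real_eq_iff)
qed

text \<open>The classical octahedron argument: the four Bianchi identities that start with the cyclic
  shifts of \<open>a, b, c, d\<close> are combined modulo the antisymmetry in each pair.\<close>

lemma riemann_pair_symmetric:
  assumes "x \<in> S"
  shows "riemann G x a b c d = riemann G x c d a b"
  using riemann_bianchi[OF assms, of a b c d] riemann_bianchi[OF assms, of b c d a]
    riemann_bianchi[OF assms, of c d a b] riemann_bianchi[OF assms, of d a b c]
    riemann_antisymmetric_first_pair[OF assms, of a b c d] riemann_antisymmetric_first_pair[OF assms, of a c d b]
    riemann_antisymmetric_first_pair[OF assms, of a d b c] riemann_antisymmetric_first_pair[OF assms, of b c d a]
    riemann_antisymmetric_first_pair[OF assms, of b d a c] riemann_antisymmetric_first_pair[OF assms, of c d a b]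
    riemann_antisymmetric[of x a b c d] riemann_antisymmetric[of x a c d b] riemann_antisymmetric[of x a d b c]
    riemann_antisymmetric[of x b c d a] riemann_antisymmetric[of x b d a c] riemann_antisymmetric[of x c d a b]
    riemann_antisymmetric[of x b c a d] riemann_antisymmetric[of x c d b a]
    riemann_antisymmetric[of x c a b d] riemann_antisymmetric[of x d a b c] riemann_antisymmetric[of x d b a c]
    riemann_antisymmetric[of x d b c a] riemann_antisymmetric[of x d c a b]
  by linarith

text \<open>With the curvature, \<open>T\<close> and the products \<open>P\<close> of first derivatives treated as unknowns, what
  remains is linear algebra over the index permutations.\<close>

lemma curvature_decomposition:
  assumes x: "x \<in> S"
  shows "complex_of_real (riemann G x a b c d) =
    curvature_c G A x a b c d + curvature_f G A x a b c d + curvature_s G A x a b c d"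
proof -
  define T where "T a b c d = (\<Sum>I\<in>UNIV. A I x $ a * DD I x b c d)" for a b c d
  define P where "P a b c d = (\<Sum>I\<in>UNIV. D I x a b * D I x c d)" for a b c d
  define R where "R a b c d = complex_of_real (riemann G x a b c d)" for a b c d
  have P_commute: "P a b c d = P c d a b" for a b c d
    unfolding P_def by (simp add: mult.commute)
  have R_T: "R a b c d = T a d c b - T a c d b" for a b c d
    unfolding R_def T_def by (rule riemann_second_derivative[OF x])
  have compat: "T a d c b = - T b d c a - P d a c b - P d b c a" for a b c d
    using second_covariant_derivative_metric[OF x, of a d c b]
    unfolding T_def P_def by algebra
  have c_T: "curvature_c G A x a b c d = 1/2 * ((T a b c d - T a b d c) - (T b a c d - T b a d c)
      + (T c d a b - T c d b a) - (T d c a b - T d c b a))"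
    unfolding curvature_c_def set_product_def J_tensor_eq[OF x] T_def right_diff_distrib sum_subtractf ..
  have F_P: "(\<Sum>I\<in>UNIV. F_tensor G (A I) x a b * F_tensor G (A I) x c d)
      = P a b c d - P a b d c - P b a c d + P b a d c" for a b c d
    unfolding F_tensor_def P_def
    by (simp add: algebra_simps sum.distrib sum_subtractf)
  have S_P: "(\<Sum>I\<in>UNIV. S_tensor G (A I) x a b * S_tensor G (A I) x c d)
      = 1/4 * (P a b c d + P a b d c + P b a c d + P b a d c)" for a b c d
    unfolding S_tensor_def P_def sum.distrib[symmetric] sum_distrib_left
    by (simp add: algebra_simps)
  \<comment> \<open>In four of the eight values of \<open>T\<close> the form moves to the last index; each then completes one
    of the other four to a commutator of covariant derivatives.\<close>
  have c_R: "2 * curvature_c G A x a b c d = (R a c b d - R a d b c + R b d a c - R b c a d)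
      - (P c a b d + P c d b a) + (P d a b c + P d c b a) + (P c b a d + P c d a b) - (P d b a c + P d c a b)"
    unfolding c_T R_T compat[of d c b a] compat[of c d b a] compat[of d c a b] compat[of c d a b]
    by (simp add: algebra_simps)
  have R_sym: "R a c b d - R a d b c + R b d a c - R b c a d = 2 * R a b c d"
  proof -
    have "riemann G x a c b d - riemann G x a d b c + riemann G x b d a c - riemann G x b c a d
        = 2 * riemann G x a b c d"
      using riemann_bianchi[OF x, of a b c d] riemann_antisymmetric[of x a c d b]
        riemann_pair_symmetric[OF x, of b d a c] riemann_pair_symmetric[OF x, of b c a d]
      by linarith
    then show ?thesis
      unfolding R_def by (metis of_real_add of_real_diff of_real_mult of_real_numeral)
  qed
  show ?thesis
    unfolding R_def[symmetric] curvature_f_def curvature_s_def set_product_def F_P S_P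
    using c_R[unfolded R_sym] P_commute[of c d b a] P_commute[of d c b a] P_commute[of c b a d]
      P_commute[of c d a b] P_commute[of d b a c] P_commute[of d c a b]
    by algebra
qed

end

theorem mainTheorem3:
  fixes X :: "'m topology"
    and \<A> \<O> :: "('m, 'n::finite) chart set"
    and g :: "('m, 'n) chart \<Rightarrow> real^'n \<Rightarrow> real^'n^'n"
    and r :: nat
    and A :: "'i::finite \<Rightarrow> ('m, 'n) chart \<Rightarrow> real^'n \<Rightarrow> complex^'n"
  assumes manifold: "smooth_manifold X \<A>"
    and compact: "compact_space X"
    and connected: "connected_space X"
    and oriented: "oriented_by X \<A> \<O>"
    and metric: "pseudo_riemannian_metric \<A> r g"
    and number_of_forms: "CARD('i) = CARD('n)"
    and forms: "\<And>I. one_form \<A> (A I)"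
    and independent: "pointwise_independent \<A> A"
    and factorization: "factorizes_metric \<A> A g"
  shows "\<forall>\<kappa>\<in>\<A>. \<forall>x\<in>coord_range \<kappa>. \<forall>a b c d.
    complex_of_real (riemann (g \<kappa>) x a b c d) =
      curvature_c (g \<kappa>) (\<lambda>I. A I \<kappa>) x a b c d
    + curvature_f (g \<kappa>) (\<lambda>I. A I \<kappa>) x a b c d
    + curvature_s (g \<kappa>) (\<lambda>I. A I \<kappa>) x a b c d"
proof (intro ballI allI)
  fix \<kappa> x a b c d
  assume \<kappa>: "\<kappa> \<in> \<A>" and x: "x \<in> coord_range \<kappa>"
  interpret metric_factorization "coord_range \<kappa>" "g \<kappa>" "\<lambda>I. A I \<kappa>"
  proof
    show "open (coord_range \<kappa>)"
      using manifold \<kappa> by (simp add: smooth_manifold_def smooth_atlas_def is_chart_def coord_range_def)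
    show "Ck_on 2 (g \<kappa>) (coord_range \<kappa>)"
      using metric \<kappa> by (simp add: pseudo_riemannian_metric_def smooth_on_def)
    show "Ck_on 2 (A I \<kappa>) (coord_range \<kappa>)" for I
      using forms[of I] \<kappa> by (simp add: one_form_def smooth_on_def)
    fix y a b
    assume y: "y \<in> coord_range \<kappa>"
    have "transpose (g \<kappa> y) = g \<kappa> y" and sig: "has_signature (g \<kappa> y) r"
      using metric \<kappa> y unfolding pseudo_riemannian_metric_def by blast+
    then have "transpose (g \<kappa> y) $ a $ b = g \<kappa> y $ a $ b"
      by simp
    then show "g \<kappa> y $ a $ b = g \<kappa> y $ b $ a"
      by (simp add: transpose_def)
    show "det (g \<kappa> y) \<noteq> 0"
      using has_signature_det_nonzero[OF sig] .
    show "complex_of_real (g \<kappa> y $ a $ b) = (\<Sum>I\<in>UNIV. A I \<kappa> y $ a * A I \<kappa> y $ b)"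
      using factorization \<kappa> y by (simp add: factorizes_metric_def set_product_def)
  qed
  show "complex_of_real (riemann (g \<kappa>) x a b c d) =
      curvature_c (g \<kappa>) (\<lambda>I. A I \<kappa>) x a b c d
    + curvature_f (g \<kappa>) (\<lambda>I. A I \<kappa>) x a b c d
    + curvature_s (g \<kappa>) (\<lambda>I. A I \<kappa>) x a b c d"
    by (rule curvature_decomposition[OF x])
qed

end
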